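(* Let $G=\mathbb{Z}_{p^3}$ for a prime $p$, let $S$ be a proper subset of $G\setminus\{0\}$ that generates $G$, and let $S_0=S\cup\{0\}$. Let $0\in C\subseteq G$. Then $C$ is a perfect code in $\mathrm{Cay}(G,S)$ if and only if there are $\alpha_i$'s and $\lambda_i$'s in $G$ with $\alpha_0=\lambda_0=0$ such that $(S_0,C)$ is one of the following pairs: (1) $S_0=\{i+\alpha_ip\mid i\in[p]\}$, $C=\{ip\mid i\in[p^2]\}$; (2) $S_0=\{i+\alpha_ip+jp^2\mid i,j\in[p]\}$, $C=\{ip+\lambda_ip^2\mid i\in[p]\}$; (3) $S_0=\{i+\alpha_ip^2\mid i\in[p^2]\}$, $C=\{ip^2\mid i\in[p]\}$.
   Context: Groups are finite abelian, written additively; $\mathbb{Z}_n$ is the group of integers modulo $n$ and $[n]=\{0,1,\dots,n-1\}$. For $S\subseteq G\setminus\{0\}$, $\mathrm{Cay}(G,S)$ is the directed graph with vertex set $G$ and an arc from $x$ to $y$ if and only if $y-x\in S$ ($S$ is not assumed to be inverse-closed). A subset $C\subseteq G$ is a perfect code in $\mathrm{Cay}(G,S)$ if the sets $\{c\}\cup\{v:\text{there is an arc from } c \text{ to } v\}$, $c\in C$, form a partition of $G$. The families $(\alpha_i)$ and $(\lambda_i)$ are independent, one element for each value of the displayed index. *)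

theory Defs
  imports
    "HOL-Algebra.Elementary_Groups"
    "HOL-Library.Disjoint_Sets"
    "HOL-Computational_Algebra.Primes"
    "Graph_Theory.Digraph"
begin

text \<open>The group \<open>G\<close> is an abelian group in the multiplicative notation of HOL-Algebra, so
  the difference \<open>y - x\<close> of the additive notation is \<open>y \<otimes>\<^bsub>G\<^esub> inv\<^bsub>G\<^esub> x\<close>.\<close>

definition Cay :: "('a, 'b) monoid_scheme \<Rightarrow> 'a set \<Rightarrow> ('a, 'a \<times> 'a) pre_digraph" where
  "Cay G S =
     \<lparr> verts = carrier G,
       arcs = {(x, y). x \<in> carrier G \<and> y \<in> carrier G \<and> y \<otimes>\<^bsub>G\<^esub> inv\<^bsub>G\<^esub> x \<in> S},
       tail = fst, head = snd \<rparr>"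

definition closed_out_nbhd :: "('a, 'b) pre_digraph \<Rightarrow> 'a \<Rightarrow> 'a set" where
  "closed_out_nbhd D c = {c} \<union> {v. (c, v) \<in> arcs_ends D}"

text \<open>The partition is that of a family indexed by \<open>C\<close>: distinct elements of \<open>C\<close> must have
  disjoint closed out-neighbourhoods, so these may not coincide either.\<close>

definition perfect_code :: "('a, 'b) pre_digraph \<Rightarrow> 'a set \<Rightarrow> bool" where
  "perfect_code D C \<longleftrightarrow>
     C \<subseteq> verts D \<and>
     disjoint_family_on (closed_out_nbhd D) C \<and>
     (\<Union>c\<in>C. closed_out_nbhd D c) = verts D"

end

theory Submission
  imports
    Defs
    "HOL-Computational_Algebra.Polynomial"
    "HOL-Number_Theory.Cong"
begin

text \<open>A perfect code \<open>C\<close> in \<open>Cay(G, S)\<close> is the same as a direct factorisation \<open>G = S0 + C\<close>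
  (\<open>perfect_code_Cay_iff_tiling\<close>), so the classification is one of the factorisations of the cyclic
  group of order \<open>p ^ 3\<close>.

  The key fact is that a factor may be dilated: if \<open>G = A + B\<close> is direct and \<open>k\<close> is prime to \<open>|G|\<close>,
  then \<open>G = k A + B\<close> is direct as well (\<open>tiling_multiple\<close>). For prime \<open>k\<close> this is the freshman's
  dream in the group ring. In a cyclic \<open>p\<close>-group any two elements of equal \<open>p\<close>-adic valuation differ
  by a unit, and so a difference of elements of \<open>A\<close> never has the same valuation as a difference of
  elements of \<open>B\<close> (\<open>tiling_differences\<close>).

  Each of the valuations 0, 1, 2 is therefore avoided by the differences of \<open>S0\<close> or by those of
  \<open>C\<close>. As \<open>S\<close> generates the group, \<open>S0\<close> has a difference of valuation 0, so \<open>C\<close> consists of multiples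
  of \<open>p\<close>. The remaining freedom is which factor avoids 1 and which avoids 2. If \<open>S0\<close> avoids both, it
  is a transversal modulo \<open>p\<close>; if \<open>S0\<close> avoids 1 and \<open>C\<close> avoids 2, the two sets interleave; if \<open>C\<close> avoids 1
  and \<open>S0\<close> avoids 2, then \<open>C\<close> lies in the subgroup of order \<open>p\<close> and \<open>S0\<close> is a transversal modulo
  \<open>p ^ 2\<close>; and if \<open>C\<close> avoids both, then \<open>C = {0}\<close> and \<open>S0 = G\<close>, which is excluded. In each
  case the fact that every element is a sum \<open>s + c\<close> fills the sets up to the stated form. The converse
  is reading off digits in base \<open>p\<close>.\<close>

section \<open>Direct factorisations of the integers modulo n\<close>

text \<open>The elements of \<open>A\<close> and \<open>B\<close> are arbitrary integers representing residue classes, so a dilated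
  set \<open>(*) k ` A\<close> needs no reduction and dilations compose.\<close>

definition tiling :: "nat \<Rightarrow> int set \<Rightarrow> int set \<Rightarrow> bool" where
  "tiling n A B \<longleftrightarrow> bij_betw (\<lambda>(a, b). (a + b) mod int n) (A \<times> B) {0..<int n}"

lemma tiling_covers:
  assumes "tiling n A B" "0 \<le> g" "g < int n"
  obtains a b where "a \<in> A" "b \<in> B" "g = (a + b) mod int n"
proof -
  have "g \<in> (\<lambda>(a, b). (a + b) mod int n) ` (A \<times> B)"
    using assms by (simp add: tiling_def bij_betw_def)
  with that show ?thesis by auto
qed

lemma tiling_unique:
  assumes "tiling n A B" "a \<in> A" "a' \<in> A" "b \<in> B" "b' \<in> B"
    and "int n dvd (a + b) - (a' + b')"
  shows "a = a'" "b = b'"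
proof -
  have "(a + b) mod int n = (a' + b') mod int n"
    using assms by (simp add: mod_eq_dvd_iff)
  moreover have "inj_on (\<lambda>(a, b). (a + b) mod int n) (A \<times> B)"
    using assms by (simp add: tiling_def bij_betw_def)
  ultimately have "(a, b) = (a', b')"
    using assms by (intro inj_onD[where f = "\<lambda>(a, b). (a + b) mod int n" and A = "A \<times> B"]) auto
  then show "a = a'" "b = b'" by auto
qed

lemma tilingI:
  assumes "n > 0"
    and "\<And>g. 0 \<le> g \<Longrightarrow> g < int n \<Longrightarrow> \<exists>a\<in>A. \<exists>b\<in>B. int n dvd g - (a + b)"
    and "\<And>a b a' b'. a \<in> A \<Longrightarrow> b \<in> B \<Longrightarrow> a' \<in> A \<Longrightarrow> b' \<in> B \<Longrightarrow>
           int n dvd (a + b) - (a' + b') \<Longrightarrow> a = a' \<and> b = b'"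
  shows "tiling n A B"
  unfolding tiling_def bij_betw_def
proof
  show "inj_on (\<lambda>(a, b). (a + b) mod int n) (A \<times> B)"
    using assms(3) by (auto simp: inj_on_def mod_eq_dvd_iff)
  show "(\<lambda>(a, b). (a + b) mod int n) ` (A \<times> B) = {0..<int n}"
  proof safe
    fix g assume g: "g \<in> {0..<int n}"
    with assms(2)[of g] obtain a b where ab: "a \<in> A" "b \<in> B" "int n dvd g - (a + b)"
      by auto
    then have "g = (a + b) mod int n"
      using g by (metis atLeastLessThan_iff mod_eq_dvd_iff mod_pos_pos_trivial)
    with ab show "g \<in> (\<lambda>(a, b). (a + b) mod int n) ` (A \<times> B)" by force
  qed (use \<open>n > 0\<close> in auto)
qed

lemma tiling_card:
  assumes "tiling n A B"
  shows "card A * card B = n"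
  using bij_betw_same_card[OF assms[unfolded tiling_def]] by (simp add: card_cartesian_product)

lemma tiling_finite:
  assumes "tiling n A B" "n > 0"
  shows "finite A" "finite B"
  using tiling_card[OF assms(1)] assms(2) by (auto intro: card_ge_0_finite)

section \<open>Dilating a factor by a unit\<close>

text \<open>The freshman's dream in a ring of arbitrary characteristic: the middle binomial coefficients
  are divisible by the prime.\<close>

lemma prime_power_of_sum:
  fixes f :: "'b \<Rightarrow> 'a::comm_ring_1"
  assumes q: "prime (q::nat)" and "finite A"
  shows "of_nat q dvd (\<Sum>a\<in>A. f a) ^ q - (\<Sum>a\<in>A. f a ^ q)"
  using \<open>finite A\<close>
proof (induction A rule: finite_induct)
  case empty
  then show ?case using prime_gt_0_nat[OF q] by (simp add: power_0_left)
next
  case (insert x A)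
  let ?s = "\<Sum>a\<in>A. f a"
  have "of_nat q dvd (f x + ?s) ^ q - (f x ^ q + ?s ^ q)"
  proof -
    have "{..q} = insert 0 (insert q {1..<q})" using prime_gt_0_nat[OF q] by auto
    then have "(f x + ?s) ^ q = ?s ^ q + (f x ^ q +
        (\<Sum>k\<in>{1..<q}. of_nat (q choose k) * f x ^ k * ?s ^ (q - k)))"
      unfolding binomial_ring using prime_gt_0_nat[OF q] by simp
    moreover have "of_nat q dvd (\<Sum>k\<in>{1..<q}. of_nat (q choose k) * f x ^ k * ?s ^ (q - k))"
    proof (intro dvd_sum)
      fix k assume "k \<in> {1..<q}"
      then have "q dvd (q choose k)" using q by (intro dvd_choose_prime) auto
      then show "of_nat q dvd of_nat (q choose k) * f x ^ k * ?s ^ (q - k)"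
        by (metis dvd_mult2 of_nat_dvd_iff of_nat_mult dvd_def)
    qed
    ultimately show ?thesis by (simp add: algebra_simps)
  qed
  from dvd_add[OF this insert.IH] insert.hyps show ?case by (simp add: algebra_simps)
qed

text \<open>Arithmetic modulo \<open>x ^ n - 1\<close> is the arithmetic of the integral group ring of the cyclic
  group of order \<open>n\<close>; \<open>cyc_monom n a\<close> below is its basis element for the residue class of \<open>a\<close>.\<close>

definition cyc_cong :: "nat \<Rightarrow> int poly \<Rightarrow> int poly \<Rightarrow> bool" where
  "cyc_cong n f g \<longleftrightarrow> monom 1 n - 1 dvd f - g"

definition cyc_monom :: "nat \<Rightarrow> int \<Rightarrow> int poly" where
  "cyc_monom n a = monom 1 (nat (a mod int n))"

lemma cyc_cong_refl [simp, intro]: "cyc_cong n f f"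
  by (simp add: cyc_cong_def)

lemma cyc_cong_sym: "cyc_cong n f g \<Longrightarrow> cyc_cong n g f"
  unfolding cyc_cong_def by (subst minus_diff_eq[symmetric]) (simp only: dvd_minus_iff)

lemma cyc_cong_trans [trans]: "cyc_cong n f g \<Longrightarrow> cyc_cong n g h \<Longrightarrow> cyc_cong n f h"
  unfolding cyc_cong_def by (drule (1) dvd_add) simp

lemma cyc_cong_diff: "cyc_cong n f g \<Longrightarrow> cyc_cong n f' g' \<Longrightarrow> cyc_cong n (f - f') (g - g')"
  unfolding cyc_cong_def using dvd_diff[of "monom 1 n - 1" "f - g" "f' - g'"]
  by (simp add: algebra_simps)

lemma cyc_cong_mult: "cyc_cong n f g \<Longrightarrow> cyc_cong n f' g' \<Longrightarrow> cyc_cong n (f * f') (g * g')"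
proof -
  assume "cyc_cong n f g" "cyc_cong n f' g'"
  then have "monom 1 n - 1 dvd (f - g) * f' + g * (f' - g')"
    unfolding cyc_cong_def by (intro dvd_add dvd_mult dvd_mult2)
  then show ?thesis by (simp add: cyc_cong_def algebra_simps)
qed

lemma cyc_cong_sum:
  "(\<And>x. x \<in> A \<Longrightarrow> cyc_cong n (f x) (g x)) \<Longrightarrow> cyc_cong n (\<Sum>x\<in>A. f x) (\<Sum>x\<in>A. g x)"
  unfolding cyc_cong_def sum_subtractf[symmetric] by (rule dvd_sum) auto

lemma cyc_cong_monom_mod: "cyc_cong n (monom 1 i) (monom 1 (i mod n))"
proof -
  have "monom 1 i = monom 1 (i mod n) * (monom 1 n :: int poly) ^ (i div n)"
    by (simp add: monom_power mult_monom)
  then have "monom 1 i - monom 1 (i mod n) =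
      (monom 1 (i mod n) * ((monom 1 n :: int poly) ^ (i div n) - 1))"
    by (simp add: algebra_simps)
  then show ?thesis
    by (simp add: cyc_cong_def power_diff_1_eq)
qed

lemma cyc_monom_mult:
  assumes "n > 0"
  shows "cyc_cong n (cyc_monom n a * cyc_monom n b) (cyc_monom n (a + b))"
proof -
  have "int ((nat (a mod int n) + nat (b mod int n)) mod n) = (a + b) mod int n"
    using assms by (simp add: zmod_int mod_simps)
  then have "(nat (a mod int n) + nat (b mod int n)) mod n = nat ((a + b) mod int n)"
    by linarith
  then show ?thesis
    using cyc_cong_monom_mod[of n "nat (a mod int n) + nat (b mod int n)"]
    by (simp add: cyc_monom_def mult_monom)
qed

lemma cyc_monom_power:
  assumes "n > 0"
  shows "cyc_cong n (cyc_monom n a ^ k) (cyc_monom n (int k * a))"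
proof (induction k)
  case 0
  then show ?case by (simp add: cyc_monom_def)
next
  case (Suc k)
  have "cyc_cong n (cyc_monom n a ^ Suc k) (cyc_monom n a * cyc_monom n (int k * a))"
    by (simp add: cyc_cong_mult Suc.IH)
  also have "cyc_cong n \<dots> (cyc_monom n (a + int k * a))"
    using assms by (rule cyc_monom_mult)
  finally show ?case by (simp add: algebra_simps)
qed

lemma degree_cyc_monom: "n > 0 \<Longrightarrow> degree (cyc_monom n a) < n"
  by (simp add: cyc_monom_def degree_monom_eq nat_less_iff)

lemma coeff_cyc_monom:
  assumes "0 \<le> g" "g < int n"
  shows "coeff (cyc_monom n a) (nat g) = (if a mod int n = g then 1 else 0)"
proof -
  have "a mod int n \<ge> 0" using assms by simp
  with assms show ?thesis by (auto simp: cyc_monom_def eq_nat_nat_iff)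
qed

lemma degree_monom_minus_one: "n > 0 \<Longrightarrow> degree (monom 1 n - 1 :: int poly) = n"
proof -
  assume "n > 0"
  then have "degree (monom 1 n + (- 1) :: int poly) = degree (monom 1 n :: int poly)"
    by (intro degree_add_eq_left) (simp add: degree_monom_eq)
  then show ?thesis by (simp add: degree_monom_eq)
qed

text \<open>Reduced representatives are unique, so coefficients may be compared.\<close>

lemma cyc_cong_degree_less_imp_eq:
  assumes "cyc_cong n f g" "degree f < n" "degree g < n"
  shows "f = g"
proof (rule ccontr)
  assume "f \<noteq> g"
  with assms(1) have "degree (monom 1 n - 1 :: int poly) \<le> degree (f - g)"
    unfolding cyc_cong_def by (intro dvd_imp_degree_le) auto
  moreover have "degree (f - g) < n" using assms by (intro degree_diff_less)
  ultimately show False using assms by (simp add: degree_monom_minus_one)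
qed

lemma cyc_cong_reduced:
  assumes "n > 0"
  obtains r where "cyc_cong n f r" "degree r < n"
proof -
  let ?M = "monom 1 n - 1 :: int poly"
  have deg: "degree ?M = n" using assms by (rule degree_monom_minus_one)
  then have "?M \<noteq> 0" using assms by force
  have "coeff ?M (degree ?M) = 1" unfolding deg using assms by simp
  obtain q r where qr: "pseudo_divmod f ?M = (q, r)" by force
  have "f = ?M * q + r"
    using pseudo_divmod(1)[OF \<open>?M \<noteq> 0\<close> qr] \<open>coeff ?M (degree ?M) = 1\<close> by simp
  moreover have "degree r < n"
    using pseudo_divmod(2)[OF \<open>?M \<noteq> 0\<close> qr] assms deg by auto
  ultimately show ?thesis using that[of r] by (simp add: cyc_cong_def)
qed

text \<open>Write \<open>A(x)\<close>, \<open>B(x)\<close> and \<open>E(x)\<close> for the group ring elements of \<open>A\<close>, \<open>B\<close> and the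
  whole group. The tiling says \<open>A(x) B(x) = E(x)\<close>, and \<open>A(x) E(x) = |A| E(x)\<close>, so
  \<open>A(x) ^ q B(x) = |A| ^ (q - 1) E(x)\<close>. Modulo \<open>q\<close> the left side is \<open>A(x ^ q) B(x)\<close>, whose
  coefficient at \<open>g\<close> counts the representations \<open>g = q a + b\<close>. Since \<open>|A|\<close> divides \<open>n\<close> and \<open>q\<close>
  does not, the right side has no coefficient divisible by \<open>q\<close>; hence every \<open>g\<close> is represented,
  and because \<open>|A| |B| = n\<close> it is represented once.\<close>

lemma tiling_prime_multiple:
  assumes "tiling n A B" "n > 0" and q: "prime q" "coprime q n"
  shows "tiling n ((*) (int q) ` A) B"
proof -
  note fin = tiling_finite[OF assms(1,2)]
  define X where "X = cyc_monom n"
  define E where "E = (\<Sum>g\<in>{0..<int n}. X g)"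
  define sA where "sA = (\<Sum>a\<in>A. X a)"
  define sB where "sB = (\<Sum>b\<in>B. X b)"
  have X_mod: "X (a mod int n) = X a" for a by (simp add: X_def cyc_monom_def)
  have X_mult: "cyc_cong n (X a * X b) (X (a + b))" for a b
    unfolding X_def using \<open>n > 0\<close> by (rule cyc_monom_mult)
  \<comment> \<open>Multiplication by a group element permutes the group.\<close>
  have shift: "cyc_cong n (X a * E) E" for a
  proof -
    have "cyc_cong n (X a * E) (\<Sum>g\<in>{0..<int n}. X (a + g))"
      unfolding E_def sum_distrib_left by (intro cyc_cong_sum X_mult)
    also have "bij_betw (\<lambda>g. (a + g) mod int n) {0..<int n} {0..<int n}"
      by (rule bij_betwI[where g = "\<lambda>g. (g - a) mod int n"])
        (use \<open>n > 0\<close> in \<open>auto simp: mod_simps\<close>)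
    from sum.reindex_bij_betw[OF this, of X] have "(\<Sum>g\<in>{0..<int n}. X (a + g)) = E"
      by (simp add: E_def X_mod)
    finally show ?thesis .
  qed
  have prod_AB: "cyc_cong n (sA * sB) E"
  proof -
    have "sA * sB = (\<Sum>(a, b)\<in>A \<times> B. X a * X b)"
      by (simp add: sA_def sB_def sum_product sum.cartesian_product)
    also have "cyc_cong n \<dots> (\<Sum>(a, b)\<in>A \<times> B. X (a + b))"
      by (intro cyc_cong_sum) (auto intro: X_mult)
    also have "(\<Sum>(a, b)\<in>A \<times> B. X (a + b)) = E"
      unfolding E_def
      using sum.reindex_bij_betw[OF assms(1)[unfolded tiling_def], of X]
      by (simp add: case_prod_beta X_mod)
    finally show ?thesis .
  qed
  have "cyc_cong n (sA ^ j * (sA * sB)) (of_nat (card A ^ j) * E)" for j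
  proof (induction j)
    case 0
    then show ?case using prod_AB by simp
  next
    case (Suc j)
    have "sA ^ Suc j * (sA * sB) = sA * (sA ^ j * (sA * sB))" by (simp add: mult.assoc)
    also have "cyc_cong n \<dots> (sA * (of_nat (card A ^ j) * E))"
      by (intro cyc_cong_mult cyc_cong_refl Suc.IH)
    also have "\<dots> = of_nat (card A ^ j) * (\<Sum>a\<in>A. X a * E)"
      by (simp add: sA_def sum_distrib_left sum_distrib_right mult_ac)
    also have "cyc_cong n \<dots> (of_nat (card A ^ j) * (\<Sum>a\<in>A. E))"
      by (intro cyc_cong_mult cyc_cong_refl cyc_cong_sum shift)
    finally show ?case by (simp add: mult_ac)
  qed
  from this[of "q - 1"] have pow: "cyc_cong n (sA ^ q * sB) (of_nat (card A ^ (q - 1)) * E)"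
    using prime_gt_0_nat[OF q(1)] by (simp add: mult.assoc[symmetric] power_Suc2[symmetric])
  \<comment> \<open>The error term \<open>q w\<close> of the freshman's dream is reduced modulo \<open>x ^ n - 1\<close>, which keeps it
    a multiple of \<open>q\<close> coefficient by coefficient.\<close>
  obtain w where w: "sA ^ q - (\<Sum>a\<in>A. X a ^ q) = of_nat q * w"
    using prime_power_of_sum[OF q(1) fin(1), of X] unfolding sA_def by (elim dvdE)
  obtain r where r: "cyc_cong n (w * sB) r" "degree r < n"
    using cyc_cong_reduced[OF \<open>n > 0\<close>] .
  define T where "T = (\<Sum>(a, b)\<in>A \<times> B. X (int q * a + b))"
  have "cyc_cong n ((\<Sum>a\<in>A. X a ^ q) * sB) T"
  proof -
    have "(\<Sum>a\<in>A. X a ^ q) * sB = (\<Sum>(a, b)\<in>A \<times> B. X a ^ q * X b)"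
      by (simp add: sB_def sum_product sum.cartesian_product)
    also have "cyc_cong n \<dots> (\<Sum>(a, b)\<in>A \<times> B. X (int q * a) * X b)"
      using cyc_monom_power[OF \<open>n > 0\<close>, of _ q] unfolding X_def
      by (intro cyc_cong_sum) (auto intro: cyc_cong_mult)
    also have "cyc_cong n \<dots> T"
      unfolding T_def by (intro cyc_cong_sum) (auto intro: X_mult)
    finally show ?thesis .
  qed
  then have "cyc_cong n T ((\<Sum>a\<in>A. X a ^ q) * sB)" by (rule cyc_cong_sym)
  also have "\<dots> = sA ^ q * sB - of_nat q * (w * sB)"
    using w by (simp add: algebra_simps)
  also have "cyc_cong n \<dots> (of_nat (card A ^ (q - 1)) * E - of_nat q * r)"
    by (intro cyc_cong_diff cyc_cong_mult cyc_cong_refl pow r)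
  finally have "cyc_cong n T (of_nat (card A ^ (q - 1)) * E - of_nat q * r)" .
  moreover have degX: "degree (X a) < n" for a
    unfolding X_def using \<open>n > 0\<close> by (rule degree_cyc_monom)
  have "degree T < n"
    unfolding T_def using \<open>n > 0\<close> degX by (intro degree_sum_less) auto
  moreover have "degree E < n"
    unfolding E_def using \<open>n > 0\<close> degX by (intro degree_sum_less) auto
  then have "degree (of_nat (card A ^ (q - 1)) * E - of_nat q * r) < n"
    using r(2) unfolding of_nat_poly
    by (intro degree_diff_less) (auto intro: le_less_trans[OF degree_smult_le])
  ultimately have T: "T = of_nat (card A ^ (q - 1)) * E - of_nat q * r"
    by (rule cyc_cong_degree_less_imp_eq)
  have covered: "\<exists>a\<in>A. \<exists>b\<in>B. (int q * a + b) mod int n = g" if g: "0 \<le> g" "g < int n" for g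
  proof (rule ccontr)
    assume none: "\<not> ?thesis"
    have "(\<Sum>x\<in>{0..<int n}. coeff (X x) (nat g)) = (\<Sum>x\<in>{0..<int n}. if x = g then 1 else 0)"
      using g by (intro sum.cong) (auto simp: X_def coeff_cyc_monom)
    then have "coeff E (nat g) = 1"
      using g by (simp add: E_def coeff_sum)
    moreover have "coeff T (nat g) = 0"
      unfolding T_def coeff_sum using none g
      by (intro sum.neutral) (auto simp: X_def coeff_cyc_monom)
    ultimately have "int (card A ^ (q - 1)) = int q * coeff r (nat g)"
      using T by (simp add: of_nat_poly)
    then have "int q dvd int (card A ^ (q - 1))" by simp
    then have "q dvd card A"
      using q(1) prime_dvd_power by (simp only: of_nat_dvd_iff) blast
    then have "q dvd n" using tiling_card[OF assms(1)] by auto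
    then show False using q by (metis coprime_absorb_left not_prime_unit)
  qed
  have "(\<lambda>(a, b). (int q * a + b) mod int n) ` (A \<times> B) = {0..<int n}"
    using covered \<open>n > 0\<close> by force
  moreover from this have "inj_on (\<lambda>(a, b). (int q * a + b) mod int n) (A \<times> B)"
    using fin tiling_card[OF assms(1)] by (intro eq_card_imp_inj_on) (auto simp: card_cartesian_product)
  ultimately have bij: "bij_betw (\<lambda>(a, b). (int q * a + b) mod int n) (A \<times> B) {0..<int n}"
    by (simp add: bij_betw_def)
  have "bij_betw (\<lambda>(a, b). (int q * a, b)) (A \<times> B) (((*) (int q) ` A) \<times> B)"
    using prime_gt_0_nat[OF q(1)] by (force simp: bij_betw_def inj_on_def)
  then show ?thesis
    unfolding tiling_def
    by (subst bij_betw_comp_iff) (use bij in \<open>auto simp: comp_def case_prod_unfold\<close>)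
qed

lemma tiling_multiple:
  assumes "tiling n A B" "n > 0" "coprime k n" "k > 0"
  shows "tiling n ((*) (int k) ` A) B"
  using assms(3,4)
proof (induction k rule: prime_divisors_induct)
  case (unit x)
  then show ?case using assms(1) by simp
next
  case (factor q x)
  then have "tiling n ((*) (int x) ` A) B" by simp
  from tiling_prime_multiple[OF this assms(2)]
  have "tiling n ((*) (int q) ` (*) (int x) ` A) B"
    using factor by simp
  then show ?case by (simp add: image_image mult.assoc)
qed simp

text \<open>In a cyclic \<open>p\<close>-group two elements with the same \<open>p\<close>-adic valuation differ by a unit factor
  \<open>k\<close>. If \<open>k (a - a') = b - b'\<close>, then \<open>k a + b' = k a' + b\<close> are two representations of one element
  in the tiling by \<open>k A\<close> and \<open>B\<close>, which is impossible. So no valuation is shared by a difference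
  from \<open>A\<close> and a difference from \<open>B\<close>.\<close>

lemma tiling_differences:
  fixes p v m :: nat
  assumes tile: "tiling (p ^ m) A B" and p: "prime p"
    and A: "a \<in> A" "a' \<in> A" "int p ^ v dvd a - a'" "\<not> int p ^ Suc v dvd a - a'"
    and B: "b \<in> B" "b' \<in> B" "int p ^ v dvd b - b'" "\<not> int p ^ Suc v dvd b - b'"
  shows False
proof -
  obtain x y where x: "a - a' = int p ^ v * x" and y: "b - b' = int p ^ v * y"
    using A B by (auto elim!: dvdE)
  have units: "\<not> int p dvd x" "\<not> int p dvd y"
    using A(4) B(4) x y by (auto simp: mult_dvd_mono)
  have p': "prime (int p)" using p by simp
  have coprime: "coprime x (int p ^ m)" "coprime y (int p ^ m)"
    using prime_imp_coprime[OF p' units(1)] prime_imp_coprime[OF p' units(2)]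
    by (simp_all add: coprime_commute)
  obtain z where z: "[x * z = 1] (mod int p ^ m)"
    using cong_solve_coprime_int[OF coprime(1)] by auto
  have zc: "coprime z (int p ^ m)"
    using z by (metis coprime_iff_invertible_int mult.commute)
  have pm: "p ^ m > 0" using prime_gt_0_nat[OF p] by simp
  \<comment> \<open>The summand \<open>p ^ m\<close> keeps \<open>k\<close> positive also for \<open>m = 0\<close>, where the residue is \<open>0\<close>.\<close>
  obtain k :: nat where k: "k > 0" "[int k = z * y] (mod int p ^ m)"
  proof
    show "nat ((z * y) mod int p ^ m) + p ^ m > 0" using pm by simp
    show "[int (nat ((z * y) mod int p ^ m) + p ^ m) = z * y] (mod int p ^ m)"
      using pm by (simp add: cong_def)
  qed
  have "coprime (z * y) (int p ^ m)"
    using zc coprime(2) by (simp only: coprime_mult_left_iff)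
  from cong_imp_coprime[OF cong_sym[OF k(2)] this] have "coprime (int k) (int (p ^ m))"
    by (simp only: of_nat_power)
  then have "tiling (p ^ m) ((*) (int k) ` A) B"
    using tiling_multiple[OF tile pm _ k(1)] by (simp only: coprime_int_iff)
  moreover have "[int k * x = y] (mod int p ^ m)"
  proof -
    have "[int k * x = z * y * x] (mod int p ^ m)"
      using k(2) by (rule cong_mult) simp
    also have "z * y * x = (x * z) * y" by simp
    also have "[(x * z) * y = 1 * y] (mod int p ^ m)"
      using z by (rule cong_mult) simp
    finally show ?thesis by simp
  qed
  then have "int p ^ m dvd int p ^ v * (int k * x - y)"
    by (simp add: cong_iff_dvd_diff)
  then have "int (p ^ m) dvd (int k * a + b') - (int k * a' + b)"
    using x y by (simp add: algebra_simps)
  ultimately have "b' = b"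
    using A B by (intro tiling_unique(2)[of "p ^ m" "(*) (int k) ` A" B "int k * a" "int k * a'" b' b]) auto
  then show False using B(4) by simp
qed

section \<open>Factorisations with a subgroup as factor\<close>

text \<open>Turns "\<open>X\<close> meets each residue class \<open>f i\<close> modulo \<open>d\<close> exactly once, and no other class" into
  the parametrised form with free multiples of \<open>d\<close>. The normalisation at \<open>0\<close> comes from \<open>0\<close> being the
  element of \<open>X\<close> in its own class.\<close>

lemma transversal_representation:
  fixes f :: "nat \<Rightarrow> int" and X :: "int set"
  assumes "d > 0" "n > 0" "d dvd n" and X: "X \<subseteq> {0..<n}" "0 \<in> X" and "f 0 = 0"
    and inj: "\<And>x y. x \<in> X \<Longrightarrow> y \<in> X \<Longrightarrow> d dvd x - y \<Longrightarrow> x = y"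
    and hit: "\<And>i. i < N \<Longrightarrow> \<exists>x\<in>X. d dvd x - f i"
    and only: "\<And>x. x \<in> X \<Longrightarrow> \<exists>i<N. d dvd x - f i"
  shows "\<exists>\<alpha>::nat \<Rightarrow> int. (\<forall>i. \<alpha> i \<in> {0..<n}) \<and> \<alpha> 0 = 0 \<and> X = {(f i + \<alpha> i * d) mod n | i. i < N}"
proof -
  define x where "x i = (SOME x. x \<in> X \<and> d dvd x - f i)" for i
  define \<alpha> where "\<alpha> i = ((x i - f i) div d) mod n" for i
  have x: "x i \<in> X" "d dvd x i - f i" if "i < N" for i
    using someI_ex[of "\<lambda>x. x \<in> X \<and> d dvd x - f i"] hit[OF that] unfolding x_def by blast+
  have x_eq: "y = x i" if "y \<in> X" "d dvd y - f i" "i < N" for y i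
    using inj[OF that(1) x(1)[OF that(3)]] dvd_diff[OF that(2) x(2)[OF that(3)]] by simp
  have "x 0 = 0"
  proof -
    have "x 0 \<in> X \<and> d dvd x 0 - f 0"
      unfolding x_def by (rule someI[of _ 0]) (simp add: X \<open>f 0 = 0\<close>)
    then show ?thesis using inj[of "x 0" 0] X \<open>f 0 = 0\<close> by simp
  qed
  have val: "(f i + \<alpha> i * d) mod n = x i" if "i < N" for i
  proof -
    have "(f i + \<alpha> i * d) mod n = (f i + (x i - f i) div d * d) mod n"
      unfolding \<alpha>_def by (metis mod_add_right_eq mod_mult_left_eq)
    also have "\<dots> = x i mod n"
      using x(2)[OF that] by simp
    finally show ?thesis using x(1)[OF that] X by auto
  qed
  have "X = {(f i + \<alpha> i * d) mod n | i. i < N}"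
  proof safe
    fix y assume y: "y \<in> X"
    then obtain i where "i < N" "d dvd y - f i" using only by blast
    then show "\<exists>i. y = (f i + \<alpha> i * d) mod n \<and> i < N"
      using x_eq[OF y] val by metis
  qed (use val x in auto)
  moreover have "\<alpha> i \<in> {0..<n}" for i using \<open>n > 0\<close> by (simp add: \<alpha>_def)
  moreover have "\<alpha> 0 = 0" using \<open>x 0 = 0\<close> \<open>f 0 = 0\<close> by (simp add: \<alpha>_def)
  ultimately show ?thesis by blast
qed

lemma eq_of_dvd_diff_interval:
  fixes x y n :: int
  assumes "x \<in> {0..<n}" "y \<in> {0..<n}" "n dvd x - y"
  shows "x = y"
  using assms by (metis atLeastLessThan_iff mod_eq_dvd_iff mod_pos_pos_trivial)

lemma dvd_diff_mod:
  fixes x y d n :: int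
  assumes "d dvd n"
  shows "d dvd y mod n - x \<longleftrightarrow> d dvd y - x" "d dvd x - y mod n \<longleftrightarrow> d dvd x - y"
  using assms by (simp_all add: mod_eq_dvd_iff[symmetric] mod_mod_cancel)

text \<open>Modulo \<open>d\<close> only \<open>A\<close> contributes to \<open>a + b\<close>, so \<open>A\<close> meets every class modulo \<open>d\<close>. A multiple of
  \<open>d\<close> then needs the element of \<open>A\<close> in the zero class, which is \<open>0\<close>, so it lies in \<open>B\<close>.\<close>

lemma tiling_subgroup_factor_imp:
  fixes d e :: nat
  assumes tile: "tiling n A B" and n: "n = d * e" "n > 0"
    and A: "A \<subseteq> {0..<int n}" "0 \<in> A" and B: "B \<subseteq> {0..<int n}"
    and mult: "\<And>b. b \<in> B \<Longrightarrow> int d dvd b"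
    and inj: "\<And>x y. x \<in> A \<Longrightarrow> y \<in> A \<Longrightarrow> int d dvd x - y \<Longrightarrow> x = y"
  shows "\<exists>\<alpha>. (\<forall>i. \<alpha> i \<in> {0..<int n}) \<and> \<alpha> 0 = 0 \<and>
    A = {(int i + \<alpha> i * int d) mod int n | i. i < d} \<and>
    B = {(int i * int d) mod int n | i. i < e}"
proof -
  have d: "d > 0" "e > 0" using n by auto
  have dn: "int d dvd int n" using n by simp
  have cover: "\<exists>a\<in>A. \<exists>b\<in>B. int d dvd a - g \<and> g = (a + b) mod int n" if g: "g \<in> {0..<int n}" for g
  proof -
    obtain a b where ab: "a \<in> A" "b \<in> B" "g = (a + b) mod int n"
      using tiling_covers[OF tile, of g] g by auto
    moreover have "int d dvd a - (a + b)" using mult[OF ab(2)] by simp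
    ultimately show ?thesis using dvd_diff_mod[OF dn] by metis
  qed
  have hit: "\<exists>x\<in>A. int d dvd x - int i" if "i < d" for i
  proof -
    have "d * 1 \<le> n" unfolding n(1) using d by (intro mult_le_mono) auto
    then have "int i \<in> {0..<int n}" using that by simp
    then show ?thesis using cover by blast
  qed
  have only: "\<exists>i<d. int d dvd x - int i" for x
    using d by (intro exI[of _ "nat (x mod int d)"]) (simp add: nat_less_iff mod_eq_dvd_iff[symmetric])
  have "\<exists>\<alpha>. (\<forall>i. \<alpha> i \<in> {0..<int n}) \<and> \<alpha> 0 = 0 \<and>
      A = {(int i + \<alpha> i * int d) mod int n | i. i < d}"
    by (rule transversal_representation[OF _ _ dn A _ inj hit only]) (use d n in auto)
  moreover have "B = {(int i * int d) mod int n | i. i < e}"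
  proof safe
    fix b assume b: "b \<in> B"
    then obtain k where k: "b = int d * k" using mult by (auto elim: dvdE)
    have b': "0 \<le> b" "b < int n" using b B by auto
    then have "0 \<le> k" "k < int e" using k d n by (auto simp: zero_le_mult_iff)
    then have "b = (int (nat k) * int d) mod int n \<and> nat k < e"
      using b' k by (auto simp: mult.commute)
    then show "\<exists>i. b = (int i * int d) mod int n \<and> i < e" by blast
  next
    fix i assume "i < e"
    let ?g = "(int i * int d) mod int n"
    obtain a b where ab: "a \<in> A" "b \<in> B" "int d dvd a - ?g" "?g = (a + b) mod int n"
      using cover[of ?g] n by auto
    then have "int d dvd a - int i * int d" using dvd_diff_mod(2)[OF dn] by blast
    then have "int d dvd a - 0" by (metis diff_add_cancel diff_zero dvd_add dvd_triv_right)
    then have "a = 0" using inj ab A by blast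
    then show "?g \<in> B" using ab B by auto
  qed
  ultimately show ?thesis by blast
qed

lemma tiling_subgroup_factor:
  fixes d e :: nat
  assumes n: "n = d * e" "n > 0"
    and A: "A = {(int i + \<alpha> i * int d) mod int n | i. i < d}"
    and B: "B = {(int i * int d) mod int n | i. i < e}"
  shows "tiling n A B"
proof (rule tilingI[OF \<open>n > 0\<close>])
  have d: "d > 0" "e > 0" using n by auto
  have dn: "int d dvd int n" using n by simp
  fix g assume "0 \<le> g" "g < int n"
  let ?i = "nat (g mod int d)"
  let ?a = "(int ?i + \<alpha> ?i * int d) mod int n"
  have "?i < d" using d by (simp add: nat_less_iff)
  then have "?a \<in> A" unfolding A by blast
  have "int d dvd g - (int ?i + \<alpha> ?i * int d)"
    using d by (simp add: mod_eq_dvd_iff[symmetric])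
  then have "int d dvd g - ?a" using dvd_diff_mod[OF dn] by blast
  then obtain k where k: "g - ?a = int d * k" by (elim dvdE)
  let ?j = "nat (k mod int e)"
  have "?j < e" using d by (simp add: nat_less_iff)
  then have "(int ?j * int d) mod int n \<in> B" unfolding B by blast
  moreover have "int n dvd (g - ?a) - int ?j * int d"
  proof -
    have "(g - ?a) - int ?j * int d = int d * (k - k mod int e)"
      using k d by (simp add: algebra_simps)
    then show ?thesis by (simp add: n(1) minus_mod_eq_mult_div)
  qed
  then have "int n dvd (g - ?a) - (int ?j * int d) mod int n"
    by (subst dvd_diff_mod(2)) simp_all
  then have "int n dvd g - (?a + (int ?j * int d) mod int n)" by (simp add: algebra_simps)
  ultimately show "\<exists>a\<in>A. \<exists>b\<in>B. int n dvd g - (a + b)" using \<open>?a \<in> A\<close> by blast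
next
  have d: "d > 0" "e > 0" using n by auto
  have dn: "int d dvd int n" using n by simp
  have Bd: "int d dvd b" if "b \<in> B" for b
    using that dn unfolding B by (auto simp: dvd_mod_iff)
  have interval: "A \<subseteq> {0..<int n}" "B \<subseteq> {0..<int n}" using \<open>n > 0\<close> unfolding A B by auto
  fix a b a' b' assume in_sets: "a \<in> A" "b \<in> B" "a' \<in> A" "b' \<in> B"
    and eq: "int n dvd (a + b) - (a' + b')"
  obtain i where i: "i < d" "a = (int i + \<alpha> i * int d) mod int n" using in_sets A by blast
  obtain i' where i': "i' < d" "a' = (int i' + \<alpha> i' * int d) mod int n" using in_sets A by blast
  have "int d dvd (a + b) - (a' + b') - (b - b')"
    using eq dn Bd in_sets by (meson dvd_diff dvd_trans)
  then have "int d dvd a - a'" by (simp add: algebra_simps)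
  then have "int d dvd (int i + \<alpha> i * int d) - (int i' + \<alpha> i' * int d)"
    unfolding i i' using dvd_diff_mod[OF dn] by blast
  then have "int d dvd (int i - int i') + int d * (\<alpha> i - \<alpha> i')" by (simp add: algebra_simps)
  then have "int d dvd int i - int i'" by (simp add: dvd_add_left_iff)
  then have "int i = int i'" using i i' by (intro eq_of_dvd_diff_interval[of _ "int d"]) auto
  then have "a = a'" using i i' by simp
  moreover from this have "b = b'"
    using eq interval in_sets by (intro eq_of_dvd_diff_interval[of _ "int n"]) auto
  ultimately show "a = a' \<and> b = b'" by simp
qed

section \<open>Factorisations with two interleaved levels\<close>

text \<open>Here \<open>A\<close> supplies the lowest and the highest digit in base \<open>p\<close> and \<open>B\<close> the middle one.
  The middle digit of an element of \<open>A\<close> is a function of its lowest digit by \<open>jump\<close>, and the highest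
  digit of an element of \<open>B\<close> is a function of the middle one by \<open>inj\<close>. That each highest digit does
  occur in \<open>A\<close> follows by decomposing the number in question: its summand from \<open>B\<close> must vanish.\<close>

lemma tiling_two_level_imp:
  fixes p n :: nat
  assumes tile: "tiling n A B" and n: "n = p ^ 3" "p > 0"
    and A: "A \<subseteq> {0..<int n}" "0 \<in> A" and B: "B \<subseteq> {0..<int n}" "0 \<in> B"
    and mult: "\<And>b. b \<in> B \<Longrightarrow> int p dvd b"
    and inj: "\<And>x y. x \<in> B \<Longrightarrow> y \<in> B \<Longrightarrow> int p ^ 2 dvd x - y \<Longrightarrow> x = y"
    and jump: "\<And>x y. x \<in> A \<Longrightarrow> y \<in> A \<Longrightarrow> int p dvd x - y \<Longrightarrow> int p ^ 2 dvd x - y"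
  shows "\<exists>\<alpha> lam. (\<forall>i. \<alpha> i \<in> {0..<int n}) \<and> (\<forall>i. lam i \<in> {0..<int n}) \<and>
    \<alpha> 0 = 0 \<and> lam 0 = 0 \<and>
    A = {(int i + \<alpha> i * int p + int j * int p ^ 2) mod int n | i j. i < p \<and> j < p} \<and>
    B = {(int i * int p + lam i * int p ^ 2) mod int n | i. i < p}"
proof -
  have n0: "n > 0" using n by simp
  have pn: "int p dvd int n" using n by (simp add: dvd_power)
  have ppn: "int p ^ 2 dvd int n" using n by (simp add: le_imp_power_dvd)
  have p_pp: "int p dvd int p ^ 2" by (simp add: dvd_power)
  have cover: "\<exists>a\<in>A. \<exists>b\<in>B. int p dvd a - g \<and> g = (a + b) mod int n" if g: "g \<in> {0..<int n}" for g
  proof -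
    obtain a b where ab: "a \<in> A" "b \<in> B" "g = (a + b) mod int n"
      using tiling_covers[OF tile, of g] g by auto
    moreover have "int p dvd a - (a + b)" using mult[OF ab(2)] by simp
    ultimately show ?thesis using dvd_diff_mod[OF pn] by metis
  qed
  have residue: "\<exists>i<p. int p dvd x - int i" for x
    using n by (intro exI[of _ "nat (x mod int p)"]) (simp add: nat_less_iff mod_eq_dvd_iff[symmetric])
  have n_split: "p * p ^ 2 = n" using n by (simp add: power_numeral_reduce)

  have hit_B: "\<exists>x\<in>B. int p ^ 2 dvd x - int i * int p" if "i < p" for i
  proof -
    have "i * p < p * p" using that n by simp
    also have "\<dots> \<le> n" unfolding n power3_eq_cube using n by simp
    finally have "int i * int p \<in> {0..<int n}" by (simp flip: of_nat_mult)
    from cover[OF this] obtain a b where ab: "a \<in> A" "b \<in> B" "int p dvd a - int i * int p"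
      "int i * int p = (a + b) mod int n" by blast
    from ab(3) have "int p dvd a - 0" by (metis diff_add_cancel diff_zero dvd_add dvd_triv_right)
    with jump[of a 0] ab A have "int p ^ 2 dvd b - (a + b)" by simp
    then have "int p ^ 2 dvd b - int i * int p" unfolding ab(4) using dvd_diff_mod(2)[OF ppn] by blast
    with ab show ?thesis by blast
  qed
  have only_B: "\<exists>i<p. int p ^ 2 dvd x - int i * int p" if x: "x \<in> B" for x
  proof -
    obtain k where k: "x = int p * k" using mult[OF x] by (elim dvdE)
    obtain i where i: "i < p" "int p dvd k - int i" using residue by blast
    then have "int p * int p dvd int p * (k - int i)" by (intro mult_dvd_mono) auto
    then have "int p ^ 2 dvd x - int i * int p" by (simp add: k power2_eq_square algebra_simps)
    with i show ?thesis by blast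
  qed
  have lam: "\<exists>lam. (\<forall>i. lam i \<in> {0..<int n}) \<and> lam 0 = 0 \<and>
      B = {(int i * int p + lam i * int p ^ 2) mod int n | i. i < p}"
    by (rule transversal_representation[OF _ _ ppn B(1) B(2) _ inj hit_B only_B])
      (use n n0 in auto)
  \<comment> \<open>Modulo \<open>p ^ 2\<close> the set \<open>A\<close> collapses to a transversal of the classes modulo \<open>p\<close>.\<close>
  define T where "T = (\<lambda>a. a mod int p ^ 2) ` A"
  have T_dvd: "int p dvd a mod int p ^ 2 - x \<longleftrightarrow> int p dvd a - x"
    "int p dvd x - a mod int p ^ 2 \<longleftrightarrow> int p dvd x - a" for a x
    using dvd_diff_mod[OF p_pp] by blast+
  have "T \<subseteq> {0..<int n}"
  proof
    fix t assume "t \<in> T"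
    then have "0 \<le> t" "t < int p ^ 2" using n by (auto simp: T_def)
    moreover have "int p ^ 2 \<le> int n" using ppn n0 by (intro zdvd_imp_le) auto
    ultimately show "t \<in> {0..<int n}" by (metis atLeastLessThan_iff order_less_le_trans)
  qed
  moreover have "0 \<in> T" using A by (force simp: T_def)
  moreover have "x = y" if "x \<in> T" "y \<in> T" "int p dvd x - y" for x y
    using that jump by (auto simp: T_def T_dvd mod_eq_dvd_iff)
  moreover have "\<exists>x\<in>T. int p dvd x - int i" if "i < p" for i
  proof -
    have "p * 1 \<le> n" unfolding n_split[symmetric] using n by (intro mult_le_mono) auto
    then have "int i \<in> {0..<int n}" using that by simp
    from cover[OF this] show ?thesis by (auto simp: T_def T_dvd)
  qed
  ultimately have "\<exists>\<alpha>. (\<forall>i. \<alpha> i \<in> {0..<int n}) \<and> \<alpha> 0 = 0 \<and>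
      T = {(int i + \<alpha> i * int p) mod int n | i. i < p}"
    using n n0 pn residue by (intro transversal_representation) simp_all
  then obtain \<alpha> where \<alpha>: "\<forall>i. \<alpha> i \<in> {0..<int n}" "\<alpha> 0 = 0"
    "T = {(int i + \<alpha> i * int p) mod int n | i. i < p}" by blast
  have "A = {(int i + \<alpha> i * int p + int j * int p ^ 2) mod int n | i j. i < p \<and> j < p}"
  proof safe
    fix a assume a: "a \<in> A"
    then have "a mod int p ^ 2 \<in> T" by (auto simp: T_def)
    then obtain i where i: "i < p" "a mod int p ^ 2 = (int i + \<alpha> i * int p) mod int n"
      using \<alpha>(3) by blast
    have "int p ^ 2 dvd (int i + \<alpha> i * int p) mod int n - a"
      unfolding i(2)[symmetric] by (simp add: mod_eq_dvd_iff[symmetric])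
    then have "int p ^ 2 dvd a - (int i + \<alpha> i * int p)"
      using dvd_diff_mod(1)[OF ppn] by (metis dvd_diff_commute)
    then obtain k where k: "a - (int i + \<alpha> i * int p) = int p ^ 2 * k" by (elim dvdE)
    obtain j where j: "j < p" "int p dvd k - int j" using residue by blast
    then have "int p ^ 2 * int p dvd int p ^ 2 * (k - int j)" by (intro mult_dvd_mono) auto
    also have "int p ^ 2 * (k - int j) = a - (int i + \<alpha> i * int p + int j * int p ^ 2)"
      using k by (simp add: algebra_simps)
    also have "int p ^ 2 * int p = int n" using n by (simp add: power_numeral_reduce)
    finally have "a mod int n = (int i + \<alpha> i * int p + int j * int p ^ 2) mod int n"
      by (simp add: mod_eq_dvd_iff)
    moreover have "a mod int n = a" using a A by auto
    ultimately show "\<exists>i j. a = (int i + \<alpha> i * int p + int j * int p ^ 2) mod int n \<and> i < p \<and> j < p"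
      using i j by metis
  next
    fix i j assume ij: "i < p" "j < p"
    let ?t = "int i + \<alpha> i * int p"
    let ?y = "(?t + int j * int p ^ 2) mod int n"
    have "?t mod int n \<in> T" using \<alpha> ij by blast
    then obtain a0 where a0: "a0 \<in> A" "?t mod int n = a0 mod int p ^ 2" by (auto simp: T_def)
    have "int p ^ 2 dvd ?t mod int n - a0"
      unfolding a0(2) by (simp add: mod_eq_dvd_iff[symmetric])
    then have "int p ^ 2 dvd ?t - a0" using dvd_diff_mod(1)[OF ppn] by blast
    then have "int p ^ 2 dvd (?t - a0) + int j * int p ^ 2" by simp
    then have "int p ^ 2 dvd (?t + int j * int p ^ 2) - a0" by (simp add: algebra_simps)
    then have y: "int p ^ 2 dvd ?y - a0" using dvd_diff_mod(1)[OF ppn] by blast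
    have "?y \<in> {0..<int n}" using n0 by simp
    from cover[OF this] obtain a b where ab: "a \<in> A" "b \<in> B" "int p dvd a - ?y" "?y = (a + b) mod int n"
      by blast
    have "int p dvd (a - ?y) + (?y - a0)" using ab(3) dvd_trans[OF p_pp y] by (rule dvd_add)
    then have "int p ^ 2 dvd a - a0" using jump ab(1) a0(1) by simp
    with y have "int p ^ 2 dvd (?y - a0) - (a - a0)" by (rule dvd_diff)
    then have "int p ^ 2 dvd (a + b) mod int n - a" unfolding ab(4) by simp
    then have "int p ^ 2 dvd (a + b) - a" using dvd_diff_mod(1)[OF ppn] by blast
    then have "b = 0" using inj[of b 0] ab B by simp
    then have "?y = a mod int n" using ab(4) by simp
    also have "\<dots> = a" using ab(1) A by auto
    finally show "?y \<in> A" using ab(1) by simp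
  qed
  with \<alpha> lam show ?thesis by blast
qed

text \<open>The three digits in base \<open>p\<close> can be solved for one after the other, from the lowest up.\<close>

lemma tiling_two_level:
  fixes p n :: nat
  assumes n: "n = p ^ 3" "p > 0"
    and A: "A = {(int i + \<alpha> i * int p + int j * int p ^ 2) mod int n | i j. i < p \<and> j < p}"
    and B: "B = {(int i * int p + lam i * int p ^ 2) mod int n | i. i < p}"
  shows "tiling n A B"
proof (rule tilingI)
  show n0: "n > 0" using n by simp
  define x where "x i j = int i + \<alpha> i * int p + int j * int p ^ 2" for i j
  define y where "y i = int i * int p + lam i * int p ^ 2" for i
  have A: "A = {x i j mod int n | i j. i < p \<and> j < p}" using A by (simp add: x_def)
  have B: "B = {y i mod int n | i. i < p}" using B by (simp add: y_def)
  have ppn: "int p ^ 2 dvd int n" and pn: "int p dvd int n"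
    using n by (simp_all add: le_imp_power_dvd dvd_power)
  have residue: "\<exists>i<p. \<exists>l. z = int i + int p * l" for z
    using n by (intro exI[of _ "nat (z mod int p)"] conjI exI[of _ "z div int p"]) (simp_all add: nat_less_iff)
  {
    fix g :: int
    obtain i k where i: "i < p" "g - \<alpha> i * int p = int i + int p * k"
    proof -
      obtain i k where "i < p" "g = int i + int p * k" using residue by blast
      then show ?thesis by (intro that[of i "k - \<alpha> i"]) (simp_all add: algebra_simps)
    qed
    obtain i' l where i': "i' < p" "k = int i' + int p * l" using residue by blast
    obtain j m where j: "j < p" "l - lam i' = int j + int p * m" using residue by blast
    have l: "l = lam i' + int j + int p * m" using j by simp
    have "g - (x i j + y i') = int n * m"
      using i(2) by (simp add: i'(2) l x_def y_def n(1) power2_eq_square power3_eq_cube algebra_simps)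
    then have "int n dvd g - (x i j + y i')" by simp
    then have "int n dvd g - (x i j mod int n + y i' mod int n)"
      by (simp add: mod_eq_dvd_iff[symmetric] mod_simps)
    then show "\<exists>a\<in>A. \<exists>b\<in>B. int n dvd g - (a + b)"
      using A B i i' j by blast
  }
  fix a b a' b' assume in_sets: "a \<in> A" "b \<in> B" "a' \<in> A" "b' \<in> B"
    and eq: "int n dvd (a + b) - (a' + b')"
  obtain i j where a: "i < p" "a = x i j mod int n" using in_sets A by blast
  obtain i' j' where a': "i' < p" "a' = x i' j' mod int n" using in_sets A by blast
  obtain k where b: "k < p" "b = y k mod int n" using in_sets B by blast
  obtain k' where b': "k' < p" "b' = y k' mod int n" using in_sets B by blast
  have eq': "int n dvd (x i j + y k) - (x i' j' + y k')"
    using eq unfolding a b a' b' by (simp add: mod_eq_dvd_iff[symmetric] mod_simps)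
  have "(x i j + y k) - (x i' j' + y k') = (int i - int i') + int p *
      (\<alpha> i - \<alpha> i' + int p * (int j - int j') + int k - int k' + int p * (lam k - lam k'))"
    by (simp add: x_def y_def power2_eq_square algebra_simps)
  with dvd_trans[OF pn eq'] have "int p dvd int i - int i'"
    by (simp add: dvd_add_left_iff)
  then have "int i = int i'" using a a' by (intro eq_of_dvd_diff_interval[of _ "int p"]) auto
  then have "i = i'" by simp
  then have "(x i j + y k) - (x i' j' + y k') = int p * (int k - int k') + int p ^ 2 *
      (int j - int j' + lam k - lam k')"
    by (simp add: x_def y_def power2_eq_square algebra_simps)
  with dvd_trans[OF ppn eq'] have "int p ^ 2 dvd int p * (int k - int k')"
    by (simp add: dvd_add_left_iff)
  then have "int p dvd int k - int k'" using n by (simp add: power2_eq_square)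
  then have "int k = int k'" using b b' by (intro eq_of_dvd_diff_interval[of _ "int p"]) auto
  then have "b = b'" using b b' by simp
  moreover from this have "a = a'"
    using eq a a' n0 by (intro eq_of_dvd_diff_interval[of _ "int n"]) auto
  ultimately show "a = a' \<and> b = b'" by simp
qed

section \<open>The possible factorisations\<close>

text \<open>A set \<open>skips\<close> the valuation \<open>v\<close> if none of its differences has it; for each \<open>v < 3\<close> one of the two
  factors does. Generation makes \<open>A\<close> attain \<open>v = 0\<close>, so \<open>B\<close> skips it, and the choices for
  \<open>v = 1, 2\<close> give four cases. If \<open>B\<close> skips all three valuations it is trivial, which forces \<open>A\<close> to
  be the whole group.\<close>

lemma tiling_cases:
  fixes p n :: nat
  assumes tile: "tiling n A B" and p: "prime p" and n: "n = p ^ 3"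
    and A: "A \<subseteq> {0..<int n}" "0 \<in> A" and B: "B \<subseteq> {0..<int n}" "0 \<in> B"
    and gen: "\<exists>a\<in>A. \<not> int p dvd a" and proper: "A \<noteq> {0..<int n}"
  obtains
    (transversal_p) "\<And>b. b \<in> B \<Longrightarrow> int p dvd b"
      "\<And>x y. x \<in> A \<Longrightarrow> y \<in> A \<Longrightarrow> int p dvd x - y \<Longrightarrow> x = y"
  | (two_level) "\<And>b. b \<in> B \<Longrightarrow> int p dvd b"
      "\<And>x y. x \<in> B \<Longrightarrow> y \<in> B \<Longrightarrow> int p ^ 2 dvd x - y \<Longrightarrow> x = y"
      "\<And>x y. x \<in> A \<Longrightarrow> y \<in> A \<Longrightarrow> int p dvd x - y \<Longrightarrow> int p ^ 2 dvd x - y"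
  | (transversal_p2) "\<And>b. b \<in> B \<Longrightarrow> int p ^ 2 dvd b"
      "\<And>x y. x \<in> A \<Longrightarrow> y \<in> A \<Longrightarrow> int p ^ 2 dvd x - y \<Longrightarrow> x = y"
proof -
  define skips where
    "skips v X \<longleftrightarrow> (\<forall>x\<in>X. \<forall>y\<in>X. int p ^ v dvd x - y \<longrightarrow> int p ^ Suc v dvd x - y)" for v X
  have skipsD: "int p ^ Suc v dvd x - y"
    if "skips v X" "x \<in> X" "y \<in> X" "int p ^ v dvd x - y" for v X x y
    using that by (auto simp: skips_def)
  have one_skips: "skips v A \<or> skips v B" for v
    using tiling_differences[OF tile[unfolded n] p] unfolding skips_def by blast
  have n_eq: "x = y" if "x \<in> A \<union> B" "y \<in> A \<union> B" "int p ^ 3 dvd x - y" for x y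
    using that A(1) B(1) n by (intro eq_of_dvd_diff_interval[of x "int n" y]) auto
  have "\<not> skips 0 A"
    using gen A(2) skipsD[of 0 A _ 0] by auto
  then have B0: "skips 0 B" using one_skips by blast
  have Bp: "int p dvd b" if "b \<in> B" for b
    using skipsD[OF B0 that B(2)] by simp
  have Sucs: "Suc 2 = (3::nat)" "Suc 1 = (2::nat)" by simp_all
  consider "skips 1 A" "skips 2 A" | "skips 1 A" "skips 2 B" | "skips 1 B" "skips 2 A"
    | "skips 1 B" "skips 2 B"
    using one_skips by blast
  then show thesis
  proof cases
    case 1
    have "x = y" if "x \<in> A" "y \<in> A" "int p dvd x - y" for x y
      using skipsD[OF 1(1) that(1,2)] skipsD[OF 1(2) that(1,2)] that n_eq[of x y] unfolding Sucs by auto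
    with Bp show thesis by (rule transversal_p)
  next
    case 2
    have "x = y" if "x \<in> B" "y \<in> B" "int p ^ 2 dvd x - y" for x y
      using skipsD[OF 2(2) that(1,2)] that n_eq[of x y] unfolding Sucs by auto
    moreover have "int p ^ 2 dvd x - y" if "x \<in> A" "y \<in> A" "int p dvd x - y" for x y
      using skipsD[OF 2(1) that(1,2)] that unfolding Sucs by auto
    ultimately show thesis using Bp by (intro two_level)
  next
    case 3
    have "int p ^ 2 dvd b" if "b \<in> B" for b
      using skipsD[OF 3(1) that B(2)] Bp[OF that] unfolding Sucs by simp
    moreover have "x = y" if "x \<in> A" "y \<in> A" "int p ^ 2 dvd x - y" for x y
      using skipsD[OF 3(2) that(1,2)] that n_eq[of x y] unfolding Sucs by auto
    ultimately show thesis by (intro transversal_p2)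
  next
    case 4
    have "b = 0" if "b \<in> B" for b
      using skipsD[OF 4(1) that B(2)] skipsD[OF 4(2) that B(2)] Bp[OF that] n_eq[of b 0] that B
      unfolding Sucs by auto
    then have "B = {0}" using B(2) by blast
    have "{0..<int n} \<subseteq> A"
    proof
      fix g assume g: "g \<in> {0..<int n}"
      then obtain a where a: "a \<in> A" "g = a mod int n"
        using tiling_covers[OF tile, of g] \<open>B = {0}\<close> by auto
      then have "g = a" using A(1) by auto
      with a show "g \<in> A" by simp
    qed
    with proper A(1) show thesis by blast
  qed
qed

section \<open>Perfect codes in Cayley digraphs of cyclic groups\<close>

lemma mem_closed_out_nbhd_Cay:
  assumes "n > 0" "c \<in> carrier (integer_mod_group n)" "S \<subseteq> carrier (integer_mod_group n)"
  shows "v \<in> closed_out_nbhd (Cay (integer_mod_group n) S) c \<longleftrightarrow>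
    v \<in> {0..<int n} \<and> (v - c) mod int n \<in> insert 0 S"
proof -
  let ?G = "integer_mod_group n"
  have carr: "carrier ?G = {0..<int n}" using \<open>n > 0\<close> by (simp add: carrier_integer_mod_group)
  have "v \<otimes>\<^bsub>?G\<^esub> inv\<^bsub>?G\<^esub> c = (v - c) mod int n"
    using assms(2) by (simp add: mod_simps)
  then have "(c, v) \<in> arcs_ends (Cay ?G S) \<longleftrightarrow> v \<in> {0..<int n} \<and> (v - c) mod int n \<in> S"
    using assms(2) carr by (force simp: arcs_ends_conv Cay_def)
  moreover have "v = c \<longleftrightarrow> v \<in> {0..<int n} \<and> (v - c) mod int n = 0"
    using assms(2) unfolding carr
    by (auto simp: mod_0_imp_dvd intro: eq_of_dvd_diff_interval)
  ultimately show ?thesis by (auto simp: closed_out_nbhd_def)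
qed

text \<open>The closed out-neighbourhood of \<open>c\<close> is the translate of \<open>S \<union> {0}\<close> by \<open>c\<close>.\<close>

lemma perfect_code_Cay_iff_tiling:
  assumes n: "n > 0" and S: "S \<subseteq> carrier (integer_mod_group n)"
    and C: "C \<subseteq> carrier (integer_mod_group n)"
  shows "perfect_code (Cay (integer_mod_group n) S) C \<longleftrightarrow> tiling n (insert 0 S) C"
proof -
  let ?G = "integer_mod_group n"
  let ?A = "insert 0 S"
  let ?N = "closed_out_nbhd (Cay ?G S)"
  have carr: "carrier ?G = {0..<int n}" using n by (simp add: carrier_integer_mod_group)
  have A: "?A \<subseteq> {0..<int n}" using n S carr by auto
  have mem: "v \<in> ?N c \<longleftrightarrow> v \<in> {0..<int n} \<and> (v - c) mod int n \<in> ?A" if "c \<in> C" for v c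
    by (rule mem_closed_out_nbhd_Cay[OF n _ S]) (use C that in auto)
  have verts: "verts (Cay ?G S) = {0..<int n}" using carr by (simp add: Cay_def)
  have code: "perfect_code (Cay ?G S) C \<longleftrightarrow>
      (\<forall>c\<in>C. \<forall>c'\<in>C. c \<noteq> c' \<longrightarrow> ?N c \<inter> ?N c' = {}) \<and> {0..<int n} \<subseteq> (\<Union>c\<in>C. ?N c)"
  proof -
    have "(\<Union>c\<in>C. ?N c) \<subseteq> {0..<int n}" using mem by auto
    then have "(\<Union>c\<in>C. ?N c) = {0..<int n} \<longleftrightarrow> {0..<int n} \<subseteq> (\<Union>c\<in>C. ?N c)" by auto
    then show ?thesis
      using C by (simp add: perfect_code_def verts carr disjoint_family_on_def)
  qed
  show ?thesis
  proof
    assume "perfect_code (Cay ?G S) C"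
    from this have disj: "c = c'" if "c \<in> C" "c' \<in> C" "v \<in> ?N c" "v \<in> ?N c'" for c c' v
      using that unfolding code by auto
    have cover: "\<exists>c\<in>C. g \<in> ?N c" if "g \<in> {0..<int n}" for g
      using \<open>perfect_code (Cay ?G S) C\<close> that unfolding code by auto
    show "tiling n ?A C"
    proof (rule tilingI[OF n])
      fix g assume "0 \<le> g" "g < int n"
      then obtain c where c: "c \<in> C" "(g - c) mod int n \<in> ?A" using cover mem by fastforce
      moreover have "int n dvd g - ((g - c) mod int n + c)"
        by (simp add: mod_eq_dvd_iff[symmetric] mod_simps)
      ultimately show "\<exists>a\<in>?A. \<exists>c\<in>C. int n dvd g - (a + c)"
        by (intro bexI[of _ "(g - c) mod int n"] bexI[of _ c])
    next
      fix a c a' c' assume in_sets: "a \<in> ?A" "c \<in> C" "a' \<in> ?A" "c' \<in> C"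
        and eq: "int n dvd (a + c) - (a' + c')"
      have recover: "((x + z) mod int n - z) mod int n = x" if "x \<in> {0..<int n}" for x z
        using that by (simp add: mod_diff_left_eq)
      define v where "v = (a + c) mod int n"
      have v': "v = (a' + c') mod int n" using eq by (simp add: v_def mod_eq_dvd_iff)
      have "(v - c) mod int n = a" "(v - c') mod int n = a'"
        using in_sets A recover[of a c] recover[of a' c'] unfolding v_def[symmetric] v'[symmetric]
        by blast+
      then have "v \<in> ?N c" "v \<in> ?N c'"
        using in_sets n by (simp_all add: mem) (simp_all add: v_def)
      then have "c = c'" using disj in_sets by blast
      moreover from this have "a = a'"
        using eq in_sets A by (intro eq_of_dvd_diff_interval[of _ "int n"]) auto
      ultimately show "a = a' \<and> c = c'" by simp
    qed
  next
    assume tile: "tiling n ?A C"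
    have "c = c'" if "c \<in> C" "c' \<in> C" "v \<in> ?N c" "v \<in> ?N c'" for c c' v
    proof (rule tiling_unique(2)[OF tile])
      show "(v - c) mod int n \<in> ?A" "(v - c') mod int n \<in> ?A" using that mem by blast+
      show "int n dvd ((v - c) mod int n + c) - ((v - c') mod int n + c')"
        by (simp add: mod_eq_dvd_iff[symmetric] mod_simps)
    qed (use that in auto)
    moreover have "{0..<int n} \<subseteq> (\<Union>c\<in>C. ?N c)"
    proof
      fix g assume g: "g \<in> {0..<int n}"
      then obtain a c where ac: "a \<in> ?A" "c \<in> C" "g = (a + c) mod int n"
        using tiling_covers[OF tile, of g] by auto
      then have "(g - c) mod int n = a" using A by (auto simp: mod_diff_left_eq)
      then have "g \<in> ?N c" using ac g mem by simp
      with ac show "g \<in> (\<Union>c\<in>C. ?N c)" by blast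
    qed
    ultimately show "perfect_code (Cay ?G S) C" unfolding code by auto
  qed
qed

text \<open>The multiples of \<open>d\<close> form a proper subgroup.\<close>

lemma generating_set_not_multiples:
  assumes n: "n > 0" and d: "d dvd n" "d \<noteq> 1"
    and S: "S \<subseteq> carrier (integer_mod_group n)"
    and gen: "generate (integer_mod_group n) S = carrier (integer_mod_group n)"
  shows "\<exists>s\<in>S. \<not> int d dvd s"
proof (rule ccontr)
  assume "\<not> ?thesis"
  then have all: "\<And>s. s \<in> S \<Longrightarrow> int d dvd s" by blast
  have dn: "int d dvd int n" using d by simp
  have "int d dvd x" if "x \<in> generate (integer_mod_group n) S" for x
    using that
  proof (induction rule: generate.induct)
    case (inv h)
    then have "h \<in> carrier (integer_mod_group n)" using S by blast
    with inv show ?case using all dn by (simp add: dvd_mod_iff)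
  qed (use all dn in \<open>auto simp: dvd_mod_iff\<close>)
  moreover have "n \<noteq> 1" using d by auto
  then have "1 \<in> generate (integer_mod_group n) S" by (simp add: gen)
  ultimately have "int d dvd 1" by blast
  with d show False by simp
qed

theorem theorem5p3:
  fixes p :: nat and G :: "int monoid" and S S0 C :: "int set"
  assumes "prime p"
    and "G = integer_mod_group (p ^ 3)"
    and "S \<subset> carrier G - {0}"
    and "generate G S = carrier G"
    and "S0 = S \<union> {0}"
    and "0 \<in> C" and "C \<subseteq> carrier G"
  shows "perfect_code (Cay G S) C \<longleftrightarrow>
    (\<exists>\<alpha> lam :: nat \<Rightarrow> int.
       (\<forall>i<p ^ 2. \<alpha> i \<in> carrier G) \<and> (\<forall>i<p. lam i \<in> carrier G) \<and>
       \<alpha> 0 = 0 \<and> lam 0 = 0 \<and>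
       (S0 = {(int i + \<alpha> i * int p) mod int (p ^ 3) | i. i < p} \<and>
        C = {(int i * int p) mod int (p ^ 3) | i. i < p ^ 2}
      \<or> S0 = {(int i + \<alpha> i * int p + int j * int p ^ 2) mod int (p ^ 3) | i j. i < p \<and> j < p} \<and>
        C = {(int i * int p + lam i * int p ^ 2) mod int (p ^ 3) | i. i < p}
      \<or> S0 = {(int i + \<alpha> i * int p ^ 2) mod int (p ^ 3) | i. i < p ^ 2} \<and>
        C = {(int i * int p ^ 2) mod int (p ^ 3) | i. i < p}))"
    (is "_ \<longleftrightarrow> (\<exists>\<alpha> lam. ?carrier \<alpha> lam \<and> ?rest \<alpha> lam)")
proof -
  define n where "n = p ^ 3"
  have p0: "p > 0" and n0: "n > 0" using prime_gt_0_nat[OF assms(1)] by (simp_all add: n_def)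
  have n1: "n = p * p ^ 2" and n2: "n = p ^ 2 * p" by (simp_all add: n_def power_numeral_reduce)
  have carr: "carrier G = {0..<int n}"
    using n0 assms(2) by (simp add: carrier_integer_mod_group n_def)
  have S0: "S0 = insert 0 S" "S0 \<subseteq> {0..<int n}" "0 \<in> S0" "S0 \<noteq> {0..<int n}"
    using assms(3,5) n0 unfolding carr by auto
  have C: "C \<subseteq> {0..<int n}" "0 \<in> C" using assms carr by auto
  have "perfect_code (Cay G S) C \<longleftrightarrow> tiling n S0 C"
    unfolding S0(1) assms(2) n_def[symmetric]
    using assms(2,3,7) n0 by (intro perfect_code_Cay_iff_tiling) (auto simp: n_def)
  also have "\<dots> \<longleftrightarrow> (\<exists>\<alpha> lam. ?carrier \<alpha> lam \<and> ?rest \<alpha> lam)"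
  proof
    assume tile: "tiling n S0 C"
    have "p dvd n" by (simp add: n1)
    moreover have "p \<noteq> 1" using assms(1) by auto
    ultimately have "\<exists>s\<in>S. \<not> int p dvd s"
      using assms(2,3,4) n0 by (intro generating_set_not_multiples[of n]) (auto simp: n_def)
    then have gen: "\<exists>s\<in>S0. \<not> int p dvd s" unfolding S0(1) by blast
    have zero: "\<exists>lam. (\<forall>i. lam i \<in> {0..<int n}) \<and> lam (0::nat) = 0"
      using n0 by (intro exI[of _ "\<lambda>_. 0"]) simp
    from tile assms(1) n_def S0(2,3) C gen S0(4)
    show "\<exists>\<alpha> lam. ?carrier \<alpha> lam \<and> ?rest \<alpha> lam"
    proof (cases rule: tiling_cases)
      case transversal_p
      from tiling_subgroup_factor_imp[OF tile n1 n0 S0(2,3) C(1) transversal_p] zero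
      show ?thesis unfolding carr n_def by blast
    next
      case two_level
      from tiling_two_level_imp[OF tile n_def p0 S0(2,3) C two_level]
      show ?thesis unfolding carr n_def by blast
    next
      case transversal_p2
      from tiling_subgroup_factor_imp[OF tile n2 n0 S0(2,3) C(1)] transversal_p2 zero
      show ?thesis unfolding carr n_def of_nat_power by blast
    qed
  next
    assume "\<exists>\<alpha> lam. ?carrier \<alpha> lam \<and> ?rest \<alpha> lam"
    then obtain \<alpha> lam where "?rest \<alpha> lam" by blast
    then show "tiling n S0 C"
      using tiling_subgroup_factor[OF n1 n0, of S0 \<alpha> C]
        tiling_two_level[OF n_def p0, of S0 \<alpha> C lam]
        tiling_subgroup_factor[OF n2 n0, of S0 \<alpha> C]
      unfolding n_def of_nat_power by blast
  qed
  finally show ?thesis by simp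
qed

end
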